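(* For each $N\ge 1$ consider the leader-follower system on the $N\times N$ 2D directed lattice, $\dot{\mathbf{x}} = -L_2 \mathbf{x} + d$, where $L_2 \in \mathbb{R}^{N^2\times N^2}$ is the lower triangular block Toeplitz matrix, with $N\times N$ blocks, having $K_2$ on the main block diagonal, $-I$ on the first block subdiagonal and $0$ in every other block, and where $K_2 \in \mathbb{R}^{N\times N}$ is the lower triangular Toeplitz matrix with $2$ on the main diagonal, $-1$ on the first subdiagonal, and $0$ everywhere else. For $n=1,\ldots,N$ let $V_n$ be the steady-state variance of the follower at the $n$th row and the $n$th column of the lattice, i.e. the $n$th diagonal element of the $n$th $N\times N$ diagonal block of $P = \int_0^\infty e^{-L_2 t} e^{-L_2^T t}\,dt$. Then $V_n$ scales asymptotically as a logarithmic function of $n$: there exist constants $c_1, c_2 > 0$ and $n_0 \ge 2$, independent of $N$, such that $c_1 \log n \le V_n \le c_2 \log n$ for all $N \ge n \ge n_0$.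
   Context: The 2D leader-follower system has followers indexed by $(n,m)$, $1\le n,m\le N$ (row $n$, column $m$), with scalar states obeying $\dot{x}_{n,m} = -(x_{n,m}-x_{n,m-1}) - (x_{n,m}-x_{n-1,m}) + d_{n,m}$, with boundary values $x_{n,0} = x_{0,m} = x_0 \equiv 0$ (the leader's state). Stacking rows, $\mathbf{x} = [\mathbf{x}_1^T \cdots \mathbf{x}_N^T]^T$ with $\mathbf{x}_n = [x_{n,1} \cdots x_{n,N}]^T$, gives $\dot{\mathbf{x}} = -L_2\mathbf{x}+d$ with $L_2$ as in the claim. The disturbance $d$ is zero-mean, unit-variance white noise, uncorrelated across followers (identity intensity matrix), so the steady-state covariance $\lim_{t\to\infty}E\{\mathbf{x}(t)\mathbf{x}^T(t)\}$ equals $P = \int_0^\infty e^{-L_2 t} e^{-L_2^T t}\,dt$. The steady-state variance of a follower is the corresponding diagonal entry of $P$. *)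

theory Defs
  imports "HOL-Analysis.Analysis" "Jordan_Normal_Form.Jordan_Normal_Form"
begin

unbundle no vec_syntax

(* Matrices are those of Jordan_Normal_Form.Matrix: their dimension is a term, so that N can be
   quantified inside a formula.  Rows and columns are counted from 0. *)

definition mat_exp :: "real mat \<Rightarrow> real mat" where
  "mat_exp A = mat (dim_row A) (dim_row A)
     (\<lambda>(i, j). \<Sum>k. (A ^\<^sub>m k) $$ (i, j) / fact k)"

lemma summable_mat_exp:
  fixes A :: "real mat"
  assumes A: "A \<in> carrier_mat d d" and ij: "i < d" "j < d"
  shows "summable (\<lambda>k. (A ^\<^sub>m k) $$ (i, j) / fact k)"
proof -
  define b where "b = Max {norm (A $$ (i, j)) | i j. i < dim_row A \<and> j < dim_col A}"
  have bA: "norm_bound A b"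
    unfolding b_def by (rule norm_bound_max)
  have pw: "A ^\<^sub>m k \<in> carrier_mat d d" for k
    using A by (rule pow_carrier_mat)
  have nb: "norm_bound (A ^\<^sub>m k) ((b * real d) ^ k)" for k
  proof (induction k)
    case 0
    then show ?case
      by (auto simp: norm_bound_def one_mat_def)
  next
    case (Suc k)
    show ?case
      using norm_bound_mult[OF pw A Suc.IH bA] by (simp add: mult_ac)
  qed
  have "norm ((A ^\<^sub>m k) $$ (i, j) / fact k) \<le> inverse (fact k) * (b * real d) ^ k" for k
    using nb[of k] pw[of k] A ij unfolding norm_bound_def
    by (auto simp: field_simps)
  then show ?thesis
    by (intro summable_comparison_test[OF _ summable_exp[of "b * real d"]]) auto
qed

definition K2 :: "nat \<Rightarrow> real mat" where
  "K2 N = mat N N (\<lambda>(i, j). if i = j then 2 else if i = Suc j then - 1 else 0)"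

(* Row i of an N^2-dimensional matrix is row (i mod N) of block row (i div N). *)
definition L2 :: "nat \<Rightarrow> real mat" where
  "L2 N = mat (N * N) (N * N) (\<lambda>(i, j).
     if i div N = j div N then K2 N $$ (i mod N, j mod N)
     else if i div N = Suc (j div N) then (- 1\<^sub>m N) $$ (i mod N, j mod N)
     else 0)"

(* -L2 is the right-hand side of the lattice dynamics: follower (r + 1, c + 1) is coupled to its left
   and upper neighbours, where a missing neighbour is the leader, at state 0. *)
lemma L2_mult_vec:
  assumes rc: "r < N" "c < N" and x: "x \<in> carrier_vec (N * N)"
  shows "(- (L2 N *\<^sub>v x)) $ (r * N + c) =
    - (x $ (r * N + c) - (if c = 0 then 0 else x $ (r * N + (c - 1))))
    - (x $ (r * N + c) - (if r = 0 then 0 else x $ ((r - 1) * N + c)))"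
proof -
  let ?i = "r * N + c"
  have i: "?i < N * N"
  proof -
    have "?i < Suc r * N" using rc by simp
    also have "\<dots> \<le> N * N" using rc by (intro mult_le_mono1) simp
    finally show ?thesis .
  qed
  have idiv: "?i div N = r" "?i mod N = c" using rc by auto
  have ent: "L2 N $$ (?i, j) =
     2 * of_bool (j = ?i) - of_bool (c \<noteq> 0 \<and> j = r * N + (c - 1))
       - of_bool (r \<noteq> 0 \<and> j = (r - 1) * N + c)" if j: "j < N * N" for j
  proof -
    define q p where "q = j div N" and "p = j mod N"
    have p: "p < N" using rc by (simp add: p_def)
    have jq: "j = q * N + p" by (simp add: q_def p_def)
    have eq: "j = a * N + b \<longleftrightarrow> q = a \<and> p = b" if "b < N" for a b
      using that p unfolding jq
      by (metis div_mult_self3 div_less add_0_right mod_mult_self3 mod_less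
          less_nat_zero_code)
    have cases: "j = ?i \<longleftrightarrow> q = r \<and> p = c"
        "j = r * N + (c - 1) \<longleftrightarrow> q = r \<and> p = c - 1"
        "j = (r - 1) * N + c \<longleftrightarrow> q = r - 1 \<and> p = c"
      using rc by (auto simp: eq)
    have "L2 N $$ (?i, j) = (if r = q then K2 N $$ (c, p)
        else if r = Suc q then (- 1\<^sub>m N) $$ (c, p) else 0)"
      unfolding L2_def q_def p_def using i j by (simp del: mult_Suc add: idiv rc(2))
    then show ?thesis
      unfolding cases using rc p by (auto simp: K2_def)
  qed
  have b: "r * N + (c - 1) < N * N" "(r - 1) * N + c < N * N"
    using i by (auto intro: le_less_trans[OF _ i] simp: mult_le_mono1)
  have "(- (L2 N *\<^sub>v x)) $ ?i = (\<Sum>j<N * N. - L2 N $$ (?i, j) * x $ j)"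
  proof -
    have d: "dim_row (L2 N) = N * N" "dim_col (L2 N) = N * N" by (simp_all add: L2_def)
    show ?thesis
      using i x d by (simp add: scalar_prod_def atLeast0LessThan sum_negf)
  qed
  also have "\<dots> = (\<Sum>j<N * N. of_bool (j = r * N + (c - 1)) * (of_bool (c \<noteq> 0) * x $ j)
      + of_bool (j = (r - 1) * N + c) * (of_bool (r \<noteq> 0) * x $ j)
      - of_bool (j = ?i) * (2 * x $ j))"
    by (intro sum.cong) (auto simp: ent)
  also have "\<dots> = of_bool (c \<noteq> 0) * x $ (r * N + (c - 1))
      + of_bool (r \<noteq> 0) * x $ ((r - 1) * N + c) - 2 * x $ ?i"
    using i b by (simp add: sum.distrib sum_subtractf of_bool_def if_distrib[of "\<lambda>y. y * _"] sum.delta cong: if_cong)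
  finally show ?thesis by (auto simp: of_bool_def)
qed

definition steady_state_cov :: "nat \<Rightarrow> real mat" where
  "steady_state_cov N = mat (N * N) (N * N) (\<lambda>(i, j).
     integral {0..} (\<lambda>t. (mat_exp ((- t) \<cdot>\<^sub>m L2 N) * mat_exp ((- t) \<cdot>\<^sub>m transpose_mat (L2 N))) $$ (i, j)))"

(* Position of the follower in row n and column m, 1 <= n, m <= N, in the stacked state vector. *)
definition follower_index :: "nat \<Rightarrow> nat \<Rightarrow> nat \<Rightarrow> nat" where
  "follower_index N n m = (n - 1) * N + (m - 1)"

definition diag_variance :: "nat \<Rightarrow> nat \<Rightarrow> real" where
  "diag_variance N n = steady_state_cov N $$ (follower_index N n n, follower_index N n n)"

end

theory Submission
  imports Defs "HOL-Probability.Distributions"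
begin

text \<open>
  Write \<open>L2 = 2 I - S\<close>, where \<open>S\<close> is the sum of the shift by one row and the shift by one
  column. The two shifts commute, so the entry of \<open>exp (- t L2)\<close> that takes a follower to the one
  \<open>a\<close> rows below and \<open>b\<close> columns to the right of it is
  \<open>exp (- 2 t) t ^ (a + b) / (a! b!)\<close>, and all other entries vanish
  (\<open>mat_exp_L2_entry\<close>). In particular, the size \<open>N\<close> of the lattice plays no role.

  The variance of follower \<open>(n, n)\<close> is the integral of the sum of the squares of the entries in one
  row, and \<open>\<integral> t ^ m exp (- 4 t) dt = m! / 4 ^ (m + 1)\<close> turns it into the sum over
  \<open>a, b < n\<close> of \<open>(2 (a + b))! / (4 ^ (2 (a + b) + 1) (a! b!)\<^sup>2)\<close>
  (\<open>diag_variance_eq_sum\<close>). Along the antidiagonal \<open>a + b = k\<close>, the identity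
  \<open>\<Sum>i\<le>k. (k choose i)\<^sup>2 = (2 k choose k)\<close> collapses the terms to \<open>w k\<^sup>2 / 4\<close> with
  \<open>w k = (2 k choose k) / 4 ^ k\<close>. The square \<open>a, b < n\<close> contains the triangle
  \<open>a + b < n\<close> and lies in the triangle \<open>a + b < 2 n\<close>, so the variance lies between the
  partial sums of \<open>w k\<^sup>2 / 4\<close> over \<open>k < n\<close> and over \<open>k < 2 n\<close>
  (\<open>sum_square_bounds\<close>). Since \<open>1 / (4 k) \<le> w k\<^sup>2 \<le> 1 / (2 k + 1)\<close> for \<open>k \<ge> 1\<close>, both partial sums
  are of the order of \<open>ln n\<close>.
\<close>

section \<open>The exponential of the lattice matrix\<close>

lemma pow_mat_Suc_left:
  fixes A :: "'a :: semiring_1 mat"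
  assumes A: "A \<in> carrier_mat d d"
  shows "A ^\<^sub>m Suc k = A * A ^\<^sub>m k"
proof (induction k)
  case 0
  then show ?case using A by simp
next
  case (Suc k)
  have "A ^\<^sub>m Suc (Suc k) = (A * A ^\<^sub>m k) * A"
    using Suc by simp
  also have "\<dots> = A * (A ^\<^sub>m k * A)"
    using A by (intro assoc_mult_mat) auto
  finally show ?case by simp
qed

lemma transpose_pow_mat:
  fixes A :: "'a :: comm_semiring_1 mat"
  assumes A: "A \<in> carrier_mat d d"
  shows "transpose_mat A ^\<^sub>m k = transpose_mat (A ^\<^sub>m k)"
proof (induction k)
  case 0
  then show ?case using A by simp
next
  case (Suc k)
  have "transpose_mat A ^\<^sub>m Suc k = transpose_mat (A ^\<^sub>m k) * transpose_mat A"
    using Suc by simp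
  also have "\<dots> = transpose_mat (A * A ^\<^sub>m k)"
    using A by (intro transpose_mult[symmetric]) auto
  finally show ?case using pow_mat_Suc_left[OF A] by simp
qed

lemma mat_exp_transpose:
  assumes "A \<in> carrier_mat d d"
  shows "mat_exp (transpose_mat A) = transpose_mat (mat_exp A)"
  using assms by (intro eq_matI) (auto simp: mat_exp_def transpose_pow_mat[OF assms])

lemma L2_carrier: "L2 N \<in> carrier_mat (N * N) (N * N)"
  by (simp add: L2_def)

lemma lattice_index_less:
  fixes r c N :: nat
  assumes "r < N" "c < N"
  shows "r * N + c < N * N"
proof -
  have "r * N + c < Suc r * N" using assms by simp
  also have "\<dots> \<le> N * N" using assms by (intro mult_le_mono1) simp
  finally show ?thesis .
qed

text \<open>The entry, divided by \<open>k!\<close>, of \<open>(t (S - 2 I)) ^ k\<close>, where \<open>S\<close> is the sum of the two commuting shifts,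
  from a lattice point to the one \<open>a\<close> rows below and \<open>b\<close> columns to the right. The \<open>k\<close> factors
  are split into \<open>a\<close> row shifts, \<open>b\<close> column shifts and \<open>k - (a + b)\<close> multiples \<open>- 2 I\<close> of
  the identity; the denominator is what the multinomial coefficient leaves after division by
  \<open>k!\<close>.\<close>

definition shift_coeff :: "real \<Rightarrow> nat \<Rightarrow> nat \<Rightarrow> nat \<Rightarrow> real" where
  "shift_coeff t k a b = (if a + b \<le> k
     then t ^ k * (- 2) ^ (k - (a + b)) / (fact a * fact b * fact (k - (a + b))) else 0)"

text \<open>The three terms on the right are the shares \<open>a\<close>, \<open>b\<close> and \<open>Suc k - (a + b)\<close> of
  the left-hand side, according to the type of the last factor.\<close>

lemma shift_coeff_Suc:
  "real (Suc k) * shift_coeff t (Suc k) a b = t *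
     ((if a = 0 then 0 else shift_coeff t k (a - 1) b)
      + (if b = 0 then 0 else shift_coeff t k a (b - 1)) - 2 * shift_coeff t k a b)"
proof (cases "a + b \<le> Suc k")
  case False
  then show ?thesis by (auto simp: shift_coeff_def)
next
  case True
  then obtain l where l: "Suc k = a + b + l" using le_Suc_ex by blast
  define X where "X = t ^ Suc k * (- 2) ^ l / (fact a * fact b * fact l)"
  have up: "t * (if a = 0 then 0 else shift_coeff t k (a - 1) b) = real a * X"
  proof (cases a)
    case (Suc a')
    then have "a' + b \<le> k" "k - (a' + b) = l" using l by auto
    then show ?thesis unfolding X_def shift_coeff_def
      using Suc by (simp add: field_simps del: of_nat_Suc)
  qed simp
  have left: "t * (if b = 0 then 0 else shift_coeff t k a (b - 1)) = real b * X"
  proof (cases b)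
    case (Suc b')
    then have "a + b' \<le> k" "k - (a + b') = l" using l by auto
    then show ?thesis unfolding X_def shift_coeff_def
      using Suc by (simp add: field_simps del: of_nat_Suc)
  qed simp
  have stay: "t * (- 2 * shift_coeff t k a b) = real l * X"
  proof (cases l)
    case 0
    then show ?thesis using l by (simp add: shift_coeff_def)
  next
    case (Suc l')
    then have "a + b \<le> k" "k - (a + b) = l'" using l by auto
    then show ?thesis unfolding X_def shift_coeff_def
      using Suc by (simp add: field_simps del: of_nat_Suc)
  qed
  have "shift_coeff t (Suc k) a b = X"
    using l by (simp add: shift_coeff_def X_def)
  then have "real (Suc k) * shift_coeff t (Suc k) a b = real a * X + real b * X + real l * X"
    using l by (simp add: algebra_simps del: of_nat_Suc)
  also have "\<dots> = t * ((if a = 0 then 0 else shift_coeff t k (a - 1) b)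
      + (if b = 0 then 0 else shift_coeff t k a (b - 1)) - 2 * shift_coeff t k a b)"
    unfolding up[symmetric] left[symmetric] stay[symmetric] by (simp add: algebra_simps)
  finally show ?thesis .
qed

text \<open>By induction on \<open>k\<close>, for a fixed column of the power: multiplication by \<open>- L2\<close> is the lattice
  dynamics (\<open>L2_mult_vec\<close>), which matches the recurrence above.\<close>

lemma L2_pow_entry:
  assumes rc: "r < N" "c < N" and rc': "r' < N" "c' < N"
  shows "(((- t) \<cdot>\<^sub>m L2 N) ^\<^sub>m k) $$ (r * N + c, r' * N + c') =
    (if r' \<le> r \<and> c' \<le> c then fact k * shift_coeff t k (r - r') (c - c') else 0)"
  using rc
proof (induction k arbitrary: r c)
  case 0
  have "r * N + c = r' * N + c' \<longleftrightarrow> r = r' \<and> c = c'"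
    using 0 rc' by (metis div_mult_self3 div_less add_0_right mod_mult_self3 mod_less
        less_nat_zero_code)
  moreover have "dim_row (L2 N) = N * N" by (simp add: L2_def)
  ultimately show ?case
    using lattice_index_less[OF 0] lattice_index_less[OF rc']
    by (auto simp: shift_coeff_def)
next
  case (Suc k)
  let ?A = "(- t) \<cdot>\<^sub>m L2 N" and ?j = "r' * N + c'"
  have A: "?A \<in> carrier_mat (N * N) (N * N)" using L2_carrier by simp
  have i: "r * N + c < N * N" and j: "?j < N * N"
    using lattice_index_less Suc.prems rc' by auto
  have pw: "?A ^\<^sub>m k \<in> carrier_mat (N * N) (N * N)" using A by simp
  define x where "x = col (?A ^\<^sub>m k) ?j"
  have x: "x \<in> carrier_vec (N * N)" unfolding x_def by (rule carrier_vecI) (simp add: L2_def)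
  have xi: "x $ (p * N + q) = (if r' \<le> p \<and> c' \<le> q
      then fact k * shift_coeff t k (p - r') (q - c') else 0)" if "p < N" "q < N" for p q
    using Suc.IH[OF that] lattice_index_less[OF that] j carrier_matD[OF pw]
    unfolding x_def by (subst index_col) simp_all
  have "(?A ^\<^sub>m Suc k) $$ (r * N + c, ?j) = row ?A (r * N + c) \<bullet> x"
    unfolding pow_mat_Suc_left[OF A] x_def using i j A pw by (intro index_mult_mat) auto
  also have "\<dots> = t * (- (L2 N *\<^sub>v x)) $ (r * N + c)"
    using i x L2_carrier[of N] by simp
  also have "\<dots> = t * ((if r = 0 then 0 else x $ ((r - 1) * N + c))
      + (if c = 0 then 0 else x $ (r * N + (c - 1))) - 2 * x $ (r * N + c))"
    unfolding L2_mult_vec[OF Suc.prems x] by simp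
  also have "\<dots> = (if r' \<le> r \<and> c' \<le> c then fact k *
      (t * ((if r - r' = 0 then 0 else shift_coeff t k (r - r' - 1) (c - c'))
      + (if c - c' = 0 then 0 else shift_coeff t k (r - r') (c - c' - 1))
      - 2 * shift_coeff t k (r - r') (c - c'))) else 0)"
  proof -
    have up: "(if r = 0 then 0 else x $ ((r - 1) * N + c)) = (if r' \<le> r \<and> c' \<le> c then fact k *
        (if r - r' = 0 then 0 else shift_coeff t k (r - r' - 1) (c - c')) else 0)"
      using Suc.prems by (auto simp: xi)
    have left: "(if c = 0 then 0 else x $ (r * N + (c - 1))) = (if r' \<le> r \<and> c' \<le> c then fact k *
        (if c - c' = 0 then 0 else shift_coeff t k (r - r') (c - c' - 1)) else 0)"
      using Suc.prems by (cases c) (auto simp: xi le_Suc_eq Suc_diff_le)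
    have "t * ((if P then f * u else 0) + (if P then f * v else 0) - 2 * (if P then f * w else 0)) =
        (if P then f * (t * (u + v - 2 * w)) else 0)" for P and f u v w :: real
      by (simp add: algebra_simps)
    then show ?thesis
      unfolding up left xi[OF Suc.prems] .
  qed
  also have "\<dots> = (if r' \<le> r \<and> c' \<le> c
      then fact (Suc k) * shift_coeff t (Suc k) (r - r') (c - c') else 0)"
    unfolding shift_coeff_Suc[symmetric] by (simp add: algebra_simps)
  finally show ?case .
qed

lemma shift_coeff_sums:
  "(\<lambda>k. shift_coeff t k a b) sums (exp (- 2 * t) * t ^ (a + b) / (fact a * fact b))"
proof -
  have "(\<lambda>l. t ^ (a + b) / (fact a * fact b) * ((- 2 * t) ^ l /\<^sub>R fact l))
      sums (t ^ (a + b) / (fact a * fact b) * exp (- 2 * t))"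
    by (intro sums_mult exp_converges)
  moreover have "t ^ (a + b) / (fact a * fact b) * ((- 2 * t) ^ l /\<^sub>R fact l)
      = shift_coeff t (l + (a + b)) a b" for l
    unfolding power_mult_distrib by (simp add: shift_coeff_def power_add field_simps)
  ultimately have "(\<lambda>l. shift_coeff t (l + (a + b)) a b)
      sums (exp (- 2 * t) * t ^ (a + b) / (fact a * fact b))"
    by (simp add: mult_ac)
  then show ?thesis
    by (subst (asm) sums_iff_shift) (simp add: shift_coeff_def)
qed

lemma mat_exp_L2_entry:
  assumes "r < N" "c < N" "r' < N" "c' < N"
  shows "mat_exp ((- t) \<cdot>\<^sub>m L2 N) $$ (r * N + c, r' * N + c') =
    (if r' \<le> r \<and> c' \<le> c
     then exp (- 2 * t) * t ^ (r - r' + (c - c')) / (fact (r - r') * fact (c - c')) else 0)"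
proof -
  have "dim_row (L2 N) = N * N" by (simp add: L2_def)
  then have "mat_exp ((- t) \<cdot>\<^sub>m L2 N) $$ (r * N + c, r' * N + c') =
      (\<Sum>k. (((- t) \<cdot>\<^sub>m L2 N) ^\<^sub>m k) $$ (r * N + c, r' * N + c') / fact k)"
    using lattice_index_less assms by (simp add: mat_exp_def)
  also have "\<dots> = (\<Sum>k. if r' \<le> r \<and> c' \<le> c then shift_coeff t k (r - r') (c - c') else 0)"
    by (rule arg_cong[of _ _ suminf]) (auto simp: L2_pow_entry[OF assms] fun_eq_iff)
  finally show ?thesis
    unfolding sums_unique[OF shift_coeff_sums] by (cases "r' \<le> r \<and> c' \<le> c") (simp_all only: simp_thms if_True if_False suminf_zero)
qed

section \<open>The variance as a double sum\<close>

lemma sum_lattice: "(\<Sum>j<N * N. f j) = (\<Sum>r<N. \<Sum>c<N. f (r * N + c))"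
  for f :: "nat \<Rightarrow> 'a :: comm_monoid_add"
proof -
  have "(\<Sum>j<N * N. f j) = (\<Sum>r<N. sum f {r * N..<r * N + N})"
    by (rule sum.nat_group[symmetric])
  also have "\<dots> = (\<Sum>r<N. \<Sum>c<N. f (r * N + c))"
  proof (rule sum.cong[OF refl])
    fix r
    show "sum f {r * N..<r * N + N} = (\<Sum>c<N. f (r * N + c))"
      using sum.shift_bounds_nat_ivl[of f 0 "r * N" N] by (simp add: atLeast0LessThan ac_simps)
  qed
  finally show ?thesis .
qed

text \<open>The index \<open>a\<close> (or \<open>b\<close>) counts the rows (columns) from the source of the disturbance to
  follower \<open>(n, n)\<close>; only followers in rows and columns up to \<open>n\<close> act on it.\<close>

lemma cov_integrand_diag:
  assumes n: "1 \<le> n" "n \<le> N"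
  defines "i \<equiv> follower_index N n n"
  shows "(mat_exp ((- t) \<cdot>\<^sub>m L2 N) * mat_exp ((- t) \<cdot>\<^sub>m transpose_mat (L2 N))) $$ (i, i) =
    (\<Sum>a<n. \<Sum>b<n. t ^ (2 * (a + b)) * exp (- (4 * t)) / (fact a * fact b)\<^sup>2)"
proof -
  let ?A = "(- t) \<cdot>\<^sub>m L2 N"
  let ?g = "\<lambda>a b. t ^ (2 * (a + b)) * exp (- (4 * t)) / (fact a * fact b)\<^sup>2"
  have A: "?A \<in> carrier_mat (N * N) (N * N)" using L2_carrier by simp
  have d: "dim_row (mat_exp ?A) = N * N" "dim_col (mat_exp ?A) = N * N"
    by (auto simp: mat_exp_def L2_def)
  have i: "i = (n - 1) * N + (n - 1)" by (simp add: i_def follower_index_def)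
  have iN: "i < N * N" unfolding i using n by (intro lattice_index_less) auto
  have "(- t) \<cdot>\<^sub>m transpose_mat (L2 N) = transpose_mat ?A"
    by (intro eq_matI) auto
  then have "(mat_exp ?A * mat_exp ((- t) \<cdot>\<^sub>m transpose_mat (L2 N))) $$ (i, i) =
      (\<Sum>j<N * N. (mat_exp ?A $$ (i, j))\<^sup>2)"
    using iN d by (simp add: mat_exp_transpose[OF A] scalar_prod_def atLeast0LessThan power2_eq_square)
  also have "\<dots> = (\<Sum>r<N. \<Sum>c<N. (mat_exp ?A $$ (i, r * N + c))\<^sup>2)"
    by (rule sum_lattice)
  also have "\<dots> = (\<Sum>r<N. \<Sum>c<N. if r < n \<and> c < n then ?g (n - Suc r) (n - Suc c) else 0)"
  proof (intro sum.cong refl)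
    fix r c assume "r \<in> {..<N}" "c \<in> {..<N}"
    then have rc: "r < N" "c < N" by auto
    have e: "(exp (- 2 * t))\<^sup>2 = exp (- (4 * t))"
      by (simp add: power2_eq_square flip: exp_add)
    have "mat_exp ?A $$ (i, r * N + c) = (if r < n \<and> c < n then
        exp (- 2 * t) * t ^ (n - Suc r + (n - Suc c)) / (fact (n - Suc r) * fact (n - Suc c)) else 0)"
      unfolding i using n rc by (subst mat_exp_L2_entry) (auto simp: Suc_diff_Suc)
    then show "(mat_exp ?A $$ (i, r * N + c))\<^sup>2 =
        (if r < n \<and> c < n then ?g (n - Suc r) (n - Suc c) else 0)"
      using e by (simp add: power_divide power_mult_distrib power_mult[symmetric] mult.commute)
  qed
  also have "\<dots> = (\<Sum>r<n. \<Sum>c<n. ?g (n - Suc r) (n - Suc c))"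
  proof -
    have restrict: "(\<Sum>x<N. if x < n then h x else 0) = (\<Sum>x<n. h x)" for h :: "nat \<Rightarrow> real"
      using n by (intro sum.mono_neutral_cong_right) auto
    have "(\<Sum>c<N. if r < n \<and> c < n then ?g (n - Suc r) (n - Suc c) else 0) =
        (if r < n then \<Sum>c<n. ?g (n - Suc r) (n - Suc c) else 0)" for r
      using restrict[of "\<lambda>c. ?g (n - Suc r) (n - Suc c)"] by (cases "r < n") simp_all
    then show ?thesis
      by (simp only: restrict)
  qed
  also have "\<dots> = (\<Sum>a<n. \<Sum>b<n. ?g a b)"
    by (simp only: sum.nat_diff_reindex[of "\<lambda>b. ?g _ b"]
        sum.nat_diff_reindex[of "\<lambda>a. \<Sum>b<n. ?g a b"])
  finally show ?thesis .
qed

lemma has_integral_power_times_exp: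
  fixes c :: real
  assumes c: "c > 0"
  shows "((\<lambda>t. t ^ k * exp (- (c * t))) has_integral (fact k / c ^ Suc k)) {0..}"
proof -
  define f where "f x = x ^ k * exp (- x) * indicator {0..} x" for x :: real
  have f[measurable]: "f \<in> borel_measurable borel" unfolding f_def by measurable
  have "ennreal (f x) = ennreal (x ^ k * exp (- x)) * indicator {0..} x" for x
    by (auto simp: f_def indicator_def)
  then have "ennreal (fact k) = (\<integral>\<^sup>+x. f x \<partial>lborel)"
    using nn_intergal_power_times_exp_Ici[of k] by simp
  also have "\<dots> = ennreal c * (\<integral>\<^sup>+x. f (c * x) \<partial>lborel)"
    using nn_integral_real_affine[of "\<lambda>x. ennreal (f x)" c 0] c by simp
  finally have "ennreal (1 / c) * ennreal (fact k)
      = ennreal (1 / c) * ennreal c * (\<integral>\<^sup>+x. f (c * x) \<partial>lborel)"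
    by (simp add: mult.assoc)
  then have "(\<integral>\<^sup>+x. f (c * x) \<partial>lborel) = ennreal (fact k / c)"
    using c by (simp flip: ennreal_mult)
  then have "((\<lambda>x. f (c * x)) has_integral (fact k / c)) UNIV"
    using c by (intro nn_integral_has_integral) (auto simp: f_def indicator_def)
  then have "((\<lambda>x. 1 / c ^ k * f (c * x)) has_integral (1 / c ^ k * (fact k / c))) UNIV"
    by (rule has_integral_mult_right)
  moreover have "(\<lambda>x. 1 / c ^ k * f (c * x)) =
      (\<lambda>x. if x \<in> {0..} then x ^ k * exp (- (c * x)) else 0)"
    using c by (auto simp: f_def fun_eq_iff indicator_def power_mult_distrib zero_le_mult_iff)
  moreover have "1 / c ^ k * (fact k / c) = fact k / c ^ Suc k"
    by (simp add: mult.commute)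
  ultimately show ?thesis
    by (simp only: has_integral_restrict_UNIV)
qed

text \<open>The contribution to the steady-state variance of a follower of the disturbance \<open>a\<close> rows above
  and \<open>b\<close> columns to the left of it.\<close>

definition variance_term :: "nat \<Rightarrow> nat \<Rightarrow> real" where
  "variance_term a b = fact (2 * (a + b)) / (4 ^ Suc (2 * (a + b)) * (fact a * fact b)\<^sup>2)"

lemma diag_variance_eq_sum:
  assumes n: "1 \<le> n" "n \<le> N"
  shows "diag_variance N n = (\<Sum>a<n. \<Sum>b<n. variance_term a b)"
proof -
  have "((\<lambda>t. t ^ (2 * (a + b)) * exp (- (4 * t)) / (fact a * fact b)\<^sup>2)
      has_integral variance_term a b) {0..}" for a b
    using has_integral_divide[OF has_integral_power_times_exp[of 4 "2 * (a + b)"],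
        of "(fact a * fact b)\<^sup>2"]
    by (simp add: variance_term_def)
  then have "((\<lambda>t. \<Sum>a<n. \<Sum>b<n. t ^ (2 * (a + b)) * exp (- (4 * t)) / (fact a * fact b)\<^sup>2)
      has_integral (\<Sum>a<n. \<Sum>b<n. variance_term a b)) {0..}"
    by (intro has_integral_sum) auto
  moreover have "follower_index N n n < N * N"
    unfolding follower_index_def using n by (intro lattice_index_less) auto
  ultimately show ?thesis
    unfolding diag_variance_def steady_state_cov_def
    by (simp add: cov_integrand_diag[OF n] integral_unique)
qed

section \<open>Summation along antidiagonals\<close>

text \<open>The normalised central binomial coefficient: the probability that a simple random walk on the
  integers is back at its start after \<open>2 k\<close> steps.\<close>

definition central_weight :: "nat \<Rightarrow> real" where
  "central_weight k = real ((2 * k) choose k) / 4 ^ k"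

lemma variance_term_antidiagonal:
  "(\<Sum>i\<le>k. variance_term i (k - i)) = (central_weight k)\<^sup>2 / 4"
proof -
  have t: "variance_term i (k - i) =
      real ((2 * k) choose k) / 4 ^ Suc (2 * k) * real ((k choose i)\<^sup>2)" if "i \<le> k" for i
    using that by (simp add: variance_term_def binomial_fact power2_eq_square field_simps
        mult_2[symmetric])
  have "(\<Sum>i\<le>k. variance_term i (k - i)) =
      real ((2 * k) choose k) / 4 ^ Suc (2 * k) * real (\<Sum>i\<le>k. (k choose i)\<^sup>2)"
    by (simp add: t sum_distrib_left)
  also have "\<dots> = (central_weight k)\<^sup>2 / 4"
    unfolding choose_square_sum central_weight_def
    by (simp add: power2_eq_square mult_2 power_add)
  finally show ?thesis .
qed

lemma variance_term_triangle:
  "(\<Sum>(a, b)\<in>{(a, b). a + b < m}. variance_term a b) = (\<Sum>k<m. (central_weight k)\<^sup>2) / 4"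
  by (simp add: sum.triangle_reindex variance_term_antidiagonal sum_divide_distrib)

lemma sum_square_bounds:
  shows "(\<Sum>k<n. (central_weight k)\<^sup>2) / 4 \<le> (\<Sum>a<n. \<Sum>b<n. variance_term a b)"
    and "(\<Sum>a<n. \<Sum>b<n. variance_term a b) \<le> (\<Sum>k<2 * n. (central_weight k)\<^sup>2) / 4"
proof -
  have eq: "(\<Sum>a<n. \<Sum>b<n. variance_term a b) = (\<Sum>(a, b)\<in>{..<n} \<times> {..<n}. variance_term a b)"
    by (simp add: sum.cartesian_product)
  have fin: "finite {(a, b). a + b < m}" for m :: nat
    by (rule finite_subset[of _ "{..<m} \<times> {..<m}"]) auto
  have nonneg: "0 \<le> variance_term a b" for a b by (simp add: variance_term_def)
  show "(\<Sum>k<n. (central_weight k)\<^sup>2) / 4 \<le> (\<Sum>a<n. \<Sum>b<n. variance_term a b)"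
    unfolding eq variance_term_triangle[symmetric] using nonneg
    by (intro sum_mono2) auto
  show "(\<Sum>a<n. \<Sum>b<n. variance_term a b) \<le> (\<Sum>k<2 * n. (central_weight k)\<^sup>2) / 4"
    unfolding eq variance_term_triangle[symmetric] using nonneg fin
    by (intro sum_mono2) auto
qed

section \<open>Logarithmic growth\<close>

lemma central_weight_0 [simp]: "central_weight 0 = 1"
  by (simp add: central_weight_def)

lemma central_weight_Suc:
  "central_weight (Suc k) = central_weight k * (real (2 * k + 1) / real (2 * k + 2))"
proof -
  have c: "real ((2 * m) choose m) = fact (2 * m) / (fact m)\<^sup>2" for m
    using binomial_fact[of m "2 * m", where 'a = real] by (simp add: power2_eq_square mult_2)
  have "fact (2 * Suc k) = real (2 * k + 2) * (real (2 * k + 1) * fact (2 * k))"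
    by (simp add: algebra_simps)
  then show ?thesis
    unfolding central_weight_def c by (simp add: divide_simps power2_eq_square) (simp add: algebra_simps)
qed

lemma central_weight_upper: "(central_weight k)\<^sup>2 \<le> 1 / real (2 * k + 1)"
proof (induction k)
  case 0
  then show ?case by simp
next
  case (Suc k)
  have "(central_weight (Suc k))\<^sup>2 = (central_weight k)\<^sup>2 * (real (2 * k + 1) / real (2 * k + 2))\<^sup>2"
    by (simp only: central_weight_Suc power_mult_distrib)
  also have "\<dots> \<le> 1 / real (2 * k + 1) * (real (2 * k + 1) / real (2 * k + 2))\<^sup>2"
    using Suc by (intro mult_right_mono) auto
  also have "\<dots> \<le> 1 / real (2 * Suc k + 1)"
    by (simp add: divide_simps power2_eq_square) (simp add: algebra_simps)
  finally show ?case .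
qed

lemma central_weight_lower: "1 / (4 * real k) \<le> (central_weight k)\<^sup>2" if "1 \<le> k"
  using that
proof (induction k rule: dec_induct)
  case base
  have "central_weight (Suc 0) = 1 / 2" using central_weight_Suc[of 0] by simp
  then have "(central_weight (Suc 0))\<^sup>2 = 1 / 4"
    by (simp only: power2_eq_square)
  then show ?case by simp
next
  case (step k)
  have "1 / (4 * real (Suc k)) \<le> 1 / (4 * real k) * (real (2 * k + 1) / real (2 * k + 2))\<^sup>2"
    using step.hyps by (simp add: divide_simps power2_eq_square) (simp add: algebra_simps)
  also have "\<dots> \<le> (central_weight k)\<^sup>2 * (real (2 * k + 1) / real (2 * k + 2))\<^sup>2"
    using step by (intro mult_right_mono) auto
  also have "\<dots> = (central_weight (Suc k))\<^sup>2"
    by (simp only: central_weight_Suc power_mult_distrib)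
  finally show ?case .
qed

lemma ln_Suc_diff_bounds:
  assumes "n \<ge> 1"
  shows "ln (real (Suc n)) - ln (real n) \<le> 1 / real n"
    and "1 / real (Suc n) \<le> ln (real (Suc n)) - ln (real n)"
proof -
  have n: "real n > 0" using assms by simp
  have "ln (real (Suc n) / real n) \<le> real (Suc n) / real n - 1"
    using n by (intro ln_le_minus_one) simp
  then show "ln (real (Suc n)) - ln (real n) \<le> 1 / real n"
    using n by (simp add: ln_div field_simps)
  have "ln (real n / real (Suc n)) \<le> real n / real (Suc n) - 1"
    using n by (intro ln_le_minus_one) simp
  then show "1 / real (Suc n) \<le> ln (real (Suc n)) - ln (real n)"
    using n by (simp add: ln_div field_simps)
qed

lemma sum_central_weight_bounds:
  assumes "n \<ge> 1"
  shows "ln (real n) / 4 \<le> (\<Sum>k<n. (central_weight k)\<^sup>2)"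
    and "(\<Sum>k<n. (central_weight k)\<^sup>2) \<le> 1 + ln (real n)"
proof -
  show "ln (real n) / 4 \<le> (\<Sum>k<n. (central_weight k)\<^sup>2)"
    using assms
  proof (induction n rule: dec_induct)
    case (step n)
    then show ?case
      using central_weight_lower[of n] ln_Suc_diff_bounds(1)[of n] by simp
  qed simp
  show "(\<Sum>k<n. (central_weight k)\<^sup>2) \<le> 1 + ln (real n)"
    using assms
  proof (induction n rule: dec_induct)
    case (step n)
    have "(central_weight n)\<^sup>2 \<le> 1 / real (Suc n)"
      using central_weight_upper[of n] step.hyps
      by (elim order_trans) (simp add: frac_le)
    then show ?case
      using step.IH ln_Suc_diff_bounds(2)[of n] step.hyps by simp
  qed simp
qed

theorem proposition1:
  "\<exists>(c1::real) (c2::real) (n0::nat). c1 > 0 \<and> c2 > 0 \<and> n0 \<ge> 2 \<and>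
     (\<forall>(N::nat) (n::nat). n0 \<le> n \<and> n \<le> N \<longrightarrow>
        c1 * ln (real n) \<le> diag_variance N n \<and> diag_variance N n \<le> c2 * ln (real n))"
proof (intro exI conjI allI impI)
  show "(1 / 16 :: real) > 0" "(3 / 4 :: real) > 0" "(3 :: nat) \<ge> 2" by auto
  fix N n :: nat
  assume "3 \<le> n \<and> n \<le> N"
  then have n: "1 \<le> n" "n \<le> N" "3 \<le> n" by auto
  note V = diag_variance_eq_sum[OF n(1,2)]
  show "1 / 16 * ln (real n) \<le> diag_variance N n"
    unfolding V using sum_square_bounds(1)[of n] sum_central_weight_bounds(1)[OF n(1)] by simp
  \<comment> \<open>The additive constant in the upper bound is absorbed by \<open>ln n\<close>, as \<open>n \<ge> 3 > e\<close>.\<close>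
  have "exp 1 \<le> real n" using exp_le n(3) by linarith
  then have "1 \<le> ln (real n)" using n by (simp add: ln_ge_iff)
  moreover have "ln (real (2 * n)) \<le> 1 + ln (real n)"
    using n ln_le_minus_one[of 2] by (simp add: ln_mult)
  ultimately show "diag_variance N n \<le> 3 / 4 * ln (real n)"
    unfolding V using sum_square_bounds(2)[of n] sum_central_weight_bounds(2)[of "2 * n"] n(1)
    by simp
qed

end
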